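(* Let $p\equiv 1\pmod 4$ be a prime. Let $X=\{(a,b)\in V\times V : a<b<\overline{a}<\overline{b}\}$, $Y=\{(a,b)\in V\times V : a<\overline{a}<b<\overline{b}\}$, $Z=\{(a,b)\in V\times V : a<b<\overline{b}<\overline{a}\}$. Then $|X|=|Y|=|Z|=(p-1)(p-5)/96$.
   Context: For an integer $x$, $\{x\}_p$ denotes the least nonnegative residue of $x$ modulo $p$, and $\widetilde{x}=p-\{x\}_p$ if $\{x\}_p>p/2$, while $\widetilde{x}=\{x\}_p$ if $\{x\}_p<p/2$. Let $t=\prod_{x=1}^{(p-1)/2}x$ (so $t^2\equiv-1\pmod p$). Let $V=\{x : 1\le x\le (p-1)/2,\ x<\widetilde{tx}\}$, and for $a\in V$ put $\overline{a}=\widetilde{ta}$; the pairs $(a,\overline{a})$, $a\in V$, partition $\{1,\ldots,(p-1)/2\}$. *)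

theory Defs
  imports Complex_Main "HOL-Number_Theory.Cong" "HOL-Computational_Algebra.Primes"
begin

text \<open>
  \<open>tilde p x\<close> is the distance from the integer \<open>x\<close> to the nearest multiple of \<open>p\<close>. Only odd \<open>p\<close>
  are of interest, so the residue is never equal to \<open>p / 2\<close>.
\<close>

definition tilde :: "int \<Rightarrow> int \<Rightarrow> int" where
  "tilde p x = (if real_of_int (x mod p) > real_of_int p / 2 then p - x mod p else x mod p)"

definition tval :: "int \<Rightarrow> int" where
  "tval p = \<Prod>{1..(p - 1) div 2}"

definition pbar :: "int \<Rightarrow> int \<Rightarrow> int" where
  "pbar p a = tilde p (tval p * a)"

definition V :: "int \<Rightarrow> int set" where
  "V p = {x. 1 \<le> x \<and> x \<le> (p - 1) div 2 \<and> x < tilde p (tval p * x)}"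

definition X :: "int \<Rightarrow> (int \<times> int) set" where
  "X p = {(a, b) \<in> V p \<times> V p. a < b \<and> b < pbar p a \<and> pbar p a < pbar p b}"

definition Y :: "int \<Rightarrow> (int \<times> int) set" where
  "Y p = {(a, b) \<in> V p \<times> V p. a < pbar p a \<and> pbar p a < b \<and> b < pbar p b}"

definition Z :: "int \<Rightarrow> (int \<times> int) set" where
  "Z p = {(a, b) \<in> V p \<times> V p. a < b \<and> b < pbar p b \<and> pbar p b < pbar p a}"

end

theory Submission
  imports Defs "HOL-Library.Centered_Division" "HOL-Number_Theory.Residues"
begin

text \<open>
  Only \<open>t\<^sup>2 \<equiv> -1 (mod p)\<close> and the oddness of \<open>p\<close> matter. Let \<open>n = (p - 1) / 2\<close> and regard each
  pair \<open>(a, bar a)\<close>, \<open>a \<in> V\<close>, as a chord on the points \<open>1, \<dots>, n\<close>. Two chords cross (\<open>X\<close>), are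
  disjoint (\<open>Y\<close>) or are nested (\<open>Z\<close>), which gives \<open>|X| + |Y| + |Z| = n (n - 2) / 8\<close>.

  The sum of \<open>sgn (y - x) sgn (y - bar x)\<close> over all points \<open>x, y\<close> is \<open>8 |Y|\<close>; for fixed \<open>x\<close> the
  inner sum is \<open>n - 2 |bar x - x|\<close>. Since \<open>a \<mapsto> bar a - a\<close> permutes \<open>V\<close>, the \<open>bar a\<close> sum to twice
  the sum of the \<open>a\<close>, and \<open>|Y| = n (n - 2) / 24\<close> follows.

  The sum of \<open>sgn (y - x) sgn (bar y - bar x)\<close> is \<open>8 (|Y| - |Z|) - n\<close>. Extended to all residues
  and rewritten in the coordinates \<open>x = v - u\<close>, \<open>y = v + u\<close>, it becomes the square of the sum of
  \<open>\<sigma> (u) \<sigma> (t u)\<close>, where \<open>\<sigma>\<close> is the sign of the centred residue. That sum changes sign under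
  \<open>u \<mapsto> t u\<close>, so it vanishes, and accounting for the terms with \<open>x = 0\<close> or \<open>y = 0\<close> gives
  \<open>|Y| = |Z|\<close>.
\<close>

section \<open>Chords of a fixed-point-free involution\<close>

lemma sum_sum_eq_diagonal_plus_less:
  fixes g :: "'a :: linorder \<Rightarrow> 'a \<Rightarrow> 'b :: comm_monoid_add"
  assumes "finite A"
  shows "(\<Sum>x\<in>A. \<Sum>y\<in>A. g x y)
    = (\<Sum>x\<in>A. g x x) + (\<Sum>(x, y)\<in>{(x, y) \<in> A \<times> A. x < y}. g x y + g y x)"
proof -
  define diagonal lower upper where "diagonal = {(x, y) \<in> A \<times> A. x = y}"
    and "lower = {(x, y) \<in> A \<times> A. y < x}" and "upper = {(x, y) \<in> A \<times> A. x < y}"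
  note defs = diagonal_def lower_def upper_def
  let ?g = "\<lambda>(x, y). g x y"
  have fin: "finite diagonal" "finite lower" "finite upper"
    using assms by (auto intro: finite_subset[of _ "A \<times> A"] simp: defs)
  have "(\<Sum>x\<in>A. \<Sum>y\<in>A. g x y) = sum ?g (A \<times> A)"
    by (simp add: sum.cartesian_product)
  also have "A \<times> A = diagonal \<union> (upper \<union> lower)"
    by (auto simp: defs)
  also have "sum ?g \<dots> = sum ?g diagonal + (sum ?g upper + sum ?g lower)"
    using fin by (subst sum.union_disjoint; (auto simp: defs)?)+
  also have "sum ?g diagonal = (\<Sum>x\<in>A. g x x)"
    by (rule sum.reindex_bij_witness[where i = "\<lambda>x. (x, x)" and j = fst]) (auto simp: defs)
  also have "sum ?g lower = (\<Sum>(x, y)\<in>upper. g y x)"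
    by (rule sum.reindex_bij_witness[where i = prod.swap and j = prod.swap]) (auto simp: defs)
  also have "sum ?g upper + (\<Sum>(x, y)\<in>upper. g y x) = (\<Sum>(x, y)\<in>upper. g x y + g y x)"
    by (simp add: sum.distrib case_prod_unfold)
  finally show ?thesis
    unfolding upper_def .
qed

lemma sum_sgn_diff_mult_sgn_diff:
  fixes A :: "'a :: linordered_idom set"
  assumes "finite A" "x \<in> A" "z \<in> A" "x < z"
  shows "(\<Sum>y\<in>A. sgn (y - x) * sgn (y - z))
    = of_nat (card A) - 2 * of_nat (card (A \<inter> {x<..<z})) - 2"
proof -
  have "sgn (y - x) * sgn (y - z)
      = 1 - 2 * of_bool (x < y \<and> y < z) - of_bool (y = x) - of_bool (y = z)" for y
    using assms(4) by (auto simp: sgn_if)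
  moreover have "{y. x < y \<and> y < z} = {x<..<z}" "A \<inter> {y. y = x} = {x}" "A \<inter> {y. y = z} = {z}"
    using assms by auto
  ultimately show ?thesis
    using assms(1) by (simp add: sum_subtractf sum_distrib_left[symmetric])
qed

locale fixed_point_free_involution =
  fixes A :: "'a :: linordered_idom set" and f :: "'a \<Rightarrow> 'a"
  assumes finite_points: "finite A"
    and map_closed: "x \<in> A \<Longrightarrow> f x \<in> A"
    and involution: "x \<in> A \<Longrightarrow> f (f x) = x"
    and no_fixed_point: "x \<in> A \<Longrightarrow> f x \<noteq> x"
begin

definition openers :: "'a set" where
  "openers = {x \<in> A. x < f x}"

definition crossing :: "('a \<times> 'a) set" where
  "crossing = {(a, b) \<in> openers \<times> openers. a < b \<and> b < f a \<and> f a < f b}"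

definition separated :: "('a \<times> 'a) set" where
  "separated = {(a, b) \<in> openers \<times> openers. f a < b}"

definition nested :: "('a \<times> 'a) set" where
  "nested = {(a, b) \<in> openers \<times> openers. a < b \<and> f b < f a}"

lemmas chord_pair_defs = crossing_def separated_def nested_def openers_def

definition endpoint_sum :: "('a \<Rightarrow> 'a \<Rightarrow> 'b :: comm_semiring_1) \<Rightarrow> 'a \<Rightarrow> 'a \<Rightarrow> 'b" where
  "endpoint_sum g a b = g a b + g a (f b) + g (f a) b + g (f a) (f b)"

lemma finite_openers: "finite openers"
  using finite_points by (simp add: openers_def)

lemma finite_chord_pairs: "finite crossing" "finite separated" "finite nested"
  by (rule finite_subset[of _ "openers \<times> openers"];
      auto simp: crossing_def separated_def nested_def finite_openers)+

lemma points_eq: "A = openers \<union> f ` openers"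
proof (intro equalityI subsetI)
  fix x assume x: "x \<in> A"
  then have "x \<in> openers \<or> f x \<in> openers"
    using no_fixed_point[OF x] map_closed[OF x] involution[OF x] by (auto simp: openers_def)
  then show "x \<in> openers \<union> f ` openers"
    using involution[OF x] by (metis UnI1 UnI2 imageI)
qed (auto simp: openers_def map_closed)

lemma sum_eq_sum_openers: "(\<Sum>x\<in>A. g x) = (\<Sum>a\<in>openers. g a + g (f a))"
proof -
  have "openers \<inter> f ` openers = {}"
    using involution by (force simp: openers_def)
  moreover have "inj_on f openers"
    by (metis (no_types, lifting) inj_onI involution mem_Collect_eq openers_def)
  ultimately show ?thesis
    using finite_openers
    by (subst points_eq) (simp add: sum.union_disjoint sum.reindex sum.distrib)
qed

lemma card_points: "card A = 2 * card openers"
  using sum_eq_sum_openers[of "\<lambda>_. 1 :: nat"] by simp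

lemma opener_pairs_eq:
  "{(a, b) \<in> openers \<times> openers. a < b} = crossing \<union> (separated \<union> nested)"
proof -
  have "f a \<noteq> f b" "b \<noteq> f a" if "a \<in> openers" "b \<in> openers" "a < b" for a b
    using that involution[of a] involution[of b] by (auto simp: openers_def)
  then have "a < b \<longleftrightarrow> (a, b) \<in> crossing \<union> (separated \<union> nested)"
    if "a \<in> openers" "b \<in> openers" for a b
    using that unfolding chord_pair_defs by (auto simp: neq_iff)
  then show ?thesis
    by (auto simp: crossing_def separated_def nested_def)
qed

lemma sum_sum_eq_sum_endpoint_sum:
  "(\<Sum>x\<in>A. \<Sum>y\<in>A. g x y) = (\<Sum>a\<in>openers. \<Sum>b\<in>openers. endpoint_sum g a b)"
  by (simp add: sum_eq_sum_openers endpoint_sum_def sum.distrib ac_simps)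

lemma sum_sum_eq_card_chord_pairs:
  assumes crossing: "\<And>a b. (a, b) \<in> crossing \<Longrightarrow> endpoint_sum g a b + endpoint_sum g b a = c"
    and separated: "\<And>a b. (a, b) \<in> separated \<Longrightarrow> endpoint_sum g a b + endpoint_sum g b a = s"
    and nested: "\<And>a b. (a, b) \<in> nested \<Longrightarrow> endpoint_sum g a b + endpoint_sum g b a = m"
  shows "(\<Sum>x\<in>A. \<Sum>y\<in>A. g x y) = (\<Sum>a\<in>openers. endpoint_sum g a a)
    + (of_nat (card crossing) * c + (of_nat (card separated) * s + of_nat (card nested) * m))"
proof -
  let ?h = "\<lambda>(a, b). endpoint_sum g a b + endpoint_sum g b a"
  have "sum ?h (crossing \<union> (separated \<union> nested))
      = sum ?h crossing + (sum ?h separated + sum ?h nested)"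
    using finite_chord_pairs
    by (subst sum.union_disjoint; (auto simp: chord_pair_defs)?)+
  also have "sum ?h crossing = (\<Sum>_\<in>crossing. c)"
    using crossing by (intro sum.cong) auto
  also have "sum ?h separated = (\<Sum>_\<in>separated. s)"
    using separated by (intro sum.cong) auto
  also have "sum ?h nested = (\<Sum>_\<in>nested. m)"
    using nested by (intro sum.cong) auto
  finally show ?thesis
    unfolding sum_sum_eq_sum_endpoint_sum sum_sum_eq_diagonal_plus_less[OF finite_openers]
      opener_pairs_eq by simp
qed

lemma card_chord_pairs:
  "card A * card A = 2 * card A + 8 * (card crossing + card separated + card nested)"
proof -
  have "card A * card A = (\<Sum>x\<in>A. \<Sum>y\<in>A. 1)"
    by simp
  also have "\<dots> = (\<Sum>a\<in>openers. endpoint_sum (\<lambda>_ _. 1) a a)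
      + (of_nat (card crossing) * 8 + (of_nat (card separated) * 8 + of_nat (card nested) * 8))"
    by (rule sum_sum_eq_card_chord_pairs) (simp_all add: endpoint_sum_def)
  also have "(\<Sum>a\<in>openers. endpoint_sum (\<lambda>_ _. 1) a a) = 2 * card A"
    by (simp add: endpoint_sum_def card_points)
  finally show ?thesis
    by simp
qed

lemma sum_sgn_eq_card_separated:
  "(\<Sum>x\<in>A. \<Sum>y\<in>A. sgn (y - x) * sgn (y - f x)) = 8 * of_nat (card separated)"
proof -
  let ?g = "\<lambda>x y. sgn (y - x) * sgn (y - f x)"
  have "(\<Sum>x\<in>A. \<Sum>y\<in>A. ?g x y) = (\<Sum>a\<in>openers. endpoint_sum ?g a a)
      + (of_nat (card crossing) * 0 + (of_nat (card separated) * 8 + of_nat (card nested) * 0))"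
    by (rule sum_sum_eq_card_chord_pairs)
      (auto simp: endpoint_sum_def chord_pair_defs involution sgn_if)
  also have "(\<Sum>a\<in>openers. endpoint_sum ?g a a) = 0"
    by (intro sum.neutral) (auto simp: endpoint_sum_def openers_def involution)
  finally show ?thesis
    by simp
qed

lemma sum_sgn_eq_card_separated_diff_nested:
  "(\<Sum>x\<in>A. \<Sum>y\<in>A. sgn (y - x) * sgn (f y - f x))
    = 8 * of_nat (card separated) - 8 * of_nat (card nested) - of_nat (card A)"
proof -
  let ?g = "\<lambda>x y. sgn (y - x) * sgn (f y - f x)"
  have "(\<Sum>x\<in>A. \<Sum>y\<in>A. ?g x y) = (\<Sum>a\<in>openers. endpoint_sum ?g a a)
      + (of_nat (card crossing) * 0 + (of_nat (card separated) * 8 + of_nat (card nested) * - 8))"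
    by (rule sum_sum_eq_card_chord_pairs)
      (auto simp: endpoint_sum_def chord_pair_defs involution sgn_if)
  also have "(\<Sum>a\<in>openers. endpoint_sum ?g a a) = (\<Sum>a\<in>openers. - 2)"
    by (intro sum.cong) (auto simp: endpoint_sum_def openers_def involution)
  finally show ?thesis
    by (simp add: card_points)
qed

end

section \<open>Distance to the nearest multiple of an odd modulus\<close>

lemma cong_cmod: "[x cmod p = x] (mod p)"
  by (metis cong_iff_dvd_diff cong_sym dvd_triv_right minus_cmod_eq_cdiv_mult)

lemma cmod_cong:
  assumes "[x = y] (mod p)"
  shows "x cmod p = y cmod p"
proof -
  have "(x + \<bar>p\<bar> div 2) mod \<bar>p\<bar> = (y + \<bar>p\<bar> div 2) mod \<bar>p\<bar>"
    using assms by (simp add: mod_eq_dvd_iff cong_iff_dvd_diff)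
  then show ?thesis
    by (simp add: centered_modulo_def)
qed

lemma cmod_eqI:
  assumes "[x = r] (mod p)" "2 * \<bar>r\<bar> < \<bar>p\<bar>"
  shows "x cmod p = r"
proof -
  have "r cmod p = r"
    using assms(2) unfolding centered_modulo_def by (subst mod_pos_pos_trivial) linarith+
  then show ?thesis
    using cmod_cong[OF assms(1)] by simp
qed

definition tilde_cmp :: "int \<Rightarrow> int \<Rightarrow> int \<Rightarrow> int" where
  "tilde_cmp p x y = sgn (tilde p y - tilde p x)"

definition tilde_cmp_mult :: "int \<Rightarrow> int \<Rightarrow> int \<Rightarrow> int \<Rightarrow> int" where
  "tilde_cmp_mult p c x y = tilde_cmp p x y * tilde_cmp p (c * x) (c * y)"

locale odd_modulus =
  fixes p :: int
  assumes modulus_pos: "0 < p" and odd_modulus: "odd p"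
begin

definition half :: int where
  "half = (p - 1) div 2"

lemma modulus_eq: "p = 2 * half + 1"
  using odd_modulus by (simp add: half_def)

lemma half_nonneg: "0 \<le> half"
  using modulus_pos modulus_eq by linarith

lemma abs_cmod_less: "2 * \<bar>x cmod p\<bar> < p"
proof -
  have "p div 2 = half"
    using modulus_eq by simp
  then show ?thesis
    using abs_cmod_less_equal[of p x] modulus_pos modulus_eq by simp
qed

lemma minus_cmod: "(- x) cmod p = - (x cmod p)"
  using abs_cmod_less[of x] modulus_pos
  by (intro cmod_eqI) (simp_all add: cong_minus_minus_iff cong_sym cong_cmod)

lemma tilde_eq_abs_cmod: "tilde p x = \<bar>x cmod p\<bar>"
proof -
  define r where "r = x mod p"
  have r: "0 \<le> r" "r < p" "[x = r] (mod p)"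
    using modulus_pos by (simp_all add: r_def cong_def)
  have "real_of_int r > real_of_int p / 2 \<longleftrightarrow> p < 2 * r"
    by linarith
  then have tilde: "tilde p x = (if p < 2 * r then p - r else r)"
    unfolding tilde_def r_def[symmetric] by simp
  show ?thesis
  proof (cases "p < 2 * r")
    case True
    have "[x = r - p] (mod p)"
      using r(3) by (simp add: cong_def)
    then have "x cmod p = r - p"
      using True r by (intro cmod_eqI) auto
    then show ?thesis
      using True tilde r(2) by simp
  next
    case False
    then have "x cmod p = r"
      using r modulus_eq by (intro cmod_eqI) presburger+
    then show ?thesis
      using False tilde r(1) by simp
  qed
qed

lemma tilde_nonneg: "0 \<le> tilde p x"
  by (simp add: tilde_eq_abs_cmod)

lemma tilde_le_half: "tilde p x \<le> half"
  using abs_cmod_less[of x] modulus_eq by (simp add: tilde_eq_abs_cmod)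

lemma tilde_cong: "[x = y] (mod p) \<Longrightarrow> tilde p x = tilde p y"
  using cmod_cong by (simp add: tilde_eq_abs_cmod)

lemma tilde_minus [simp]: "tilde p (- x) = tilde p x"
  by (simp add: tilde_eq_abs_cmod minus_cmod)

lemma tilde_eq_min:
  assumes "\<bar>x\<bar> < p"
  shows "tilde p x = min \<bar>x\<bar> (p - \<bar>x\<bar>)"
proof (cases "\<bar>x\<bar> \<le> half")
  case True
  then have "x cmod p = x"
    using modulus_eq by (intro cmod_eqI) auto
  then show ?thesis
    using True modulus_eq by (simp add: tilde_eq_abs_cmod)
next
  case False
  have "[\<bar>x\<bar> = \<bar>x\<bar> - p] (mod p)"
    by (simp add: cong_def)
  then have "\<bar>x\<bar> cmod p = \<bar>x\<bar> - p"
    using False assms modulus_eq by (intro cmod_eqI) auto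
  moreover have "tilde p x = tilde p \<bar>x\<bar>"
    by (simp add: abs_if)
  ultimately show ?thesis
    using False assms modulus_eq by (simp add: tilde_eq_abs_cmod)
qed

lemma tilde_eq_self: "x \<in> {0..half} \<Longrightarrow> tilde p x = x"
  using modulus_eq by (subst tilde_eq_min) auto

lemma cong_sign_mult_tilde:
  obtains e :: int where "e = 1 \<or> e = - 1" "[x = e * tilde p x] (mod p)"
proof (cases "0 \<le> x cmod p")
  case True
  then show ?thesis
    using that[of 1] cong_cmod[of x p] by (simp add: tilde_eq_abs_cmod cong_sym_eq)
next
  case False
  then show ?thesis
    using that[of "- 1"] cong_cmod[of x p] by (simp add: tilde_eq_abs_cmod cong_sym_eq)
qed

lemma tilde_mult_tilde: "tilde p (c * tilde p x) = tilde p (c * x)"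
proof -
  obtain e where e: "e = 1 \<or> e = - 1" "[x = e * tilde p x] (mod p)"
    by (rule cong_sign_mult_tilde)
  have "tilde p (c * x) = tilde p (c * (e * tilde p x))"
    using e(2) by (intro tilde_cong cong_scalar_left)
  also have "\<dots> = tilde p (c * tilde p x)"
    using e(1) by auto
  finally show ?thesis
    by (rule sym)
qed

lemma tilde_eq_0_iff: "tilde p x = 0 \<longleftrightarrow> p dvd x"
proof
  assume "tilde p x = 0"
  then show "p dvd x"
    using cong_cmod[of x p] by (simp add: tilde_eq_abs_cmod cong_sym_eq[of 0] cong_0_iff)
next
  assume "p dvd x"
  then show "tilde p x = 0"
    using cmod_cong[of x 0 p] by (simp add: tilde_eq_abs_cmod cong_0_iff)
qed

lemma tilde_cmp_cong:
  "[x = x'] (mod p) \<Longrightarrow> [y = y'] (mod p) \<Longrightarrow> tilde_cmp p x y = tilde_cmp p x' y'"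
  unfolding tilde_cmp_def using tilde_cong by metis

lemma tilde_cmp_minus [simp]:
  "tilde_cmp p (- x) y = tilde_cmp p x y" "tilde_cmp p x (- y) = tilde_cmp p x y"
  by (simp_all add: tilde_cmp_def)

lemma tilde_cmp_mult_cong:
  assumes "[x = x'] (mod p)" "[y = y'] (mod p)"
  shows "tilde_cmp_mult p c x y = tilde_cmp_mult p c x' y'"
  using tilde_cmp_cong[OF assms]
    tilde_cmp_cong[OF cong_scalar_left[OF assms(1)] cong_scalar_left[OF assms(2)]]
  by (simp add: tilde_cmp_mult_def)

lemma tilde_cmp_mult_minus [simp]:
  "tilde_cmp_mult p c (- x) y = tilde_cmp_mult p c x y"
  "tilde_cmp_mult p c x (- y) = tilde_cmp_mult p c x y"
  by (simp_all add: tilde_cmp_mult_def)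

lemma tilde_cmp_diff_add_of_small:
  assumes "2 * \<bar>a\<bar> < p" "2 * \<bar>b\<bar> < p"
  shows "tilde_cmp p (b - a) (b + a) = sgn a * sgn b"
proof -
  have min: "tilde p (b - a) = min \<bar>b - a\<bar> (p - \<bar>b - a\<bar>)"
    "tilde p (b + a) = min \<bar>b + a\<bar> (p - \<bar>b + a\<bar>)"
    using assms by (intro tilde_eq_min; linarith)+
  consider (zero) "a = 0 \<or> b = 0"
    | (same_sign) "0 < a \<and> 0 < b \<or> a < 0 \<and> b < 0"
    | (opposite_sign) "0 < a \<and> b < 0 \<or> a < 0 \<and> 0 < b"
    by linarith
  then show ?thesis
  proof cases
    case zero
    then show ?thesis
      by (auto simp: tilde_cmp_def)
  next
    case same_sign
    then have "\<bar>b - a\<bar> < \<bar>b + a\<bar>" "\<bar>b - a\<bar> + \<bar>b + a\<bar> < p"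
      using assms by linarith+
    then have "tilde p (b - a) < tilde p (b + a)"
      unfolding min by linarith
    then show ?thesis
      using same_sign by (auto simp: tilde_cmp_def)
  next
    case opposite_sign
    then have "\<bar>b + a\<bar> < \<bar>b - a\<bar>" "\<bar>b - a\<bar> + \<bar>b + a\<bar> < p"
      using assms by linarith+
    then have "tilde p (b + a) < tilde p (b - a)"
      unfolding min by linarith
    then show ?thesis
      using opposite_sign by (auto simp: tilde_cmp_def)
  qed
qed

lemma tilde_cmp_diff_add: "tilde_cmp p (v - u) (v + u) = sgn (u cmod p) * sgn (v cmod p)"
proof -
  have "[v - u = v cmod p - u cmod p] (mod p)" "[v + u = v cmod p + u cmod p] (mod p)"
    by (simp_all add: cong_add cong_diff cong_cmod cong_sym)
  then have "tilde_cmp p (v - u) (v + u) = tilde_cmp p (v cmod p - u cmod p) (v cmod p + u cmod p)"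
    by (rule tilde_cmp_cong)
  also have "\<dots> = sgn (u cmod p) * sgn (v cmod p)"
    using abs_cmod_less by (intro tilde_cmp_diff_add_of_small)
  finally show ?thesis .
qed

end

section \<open>Sums over complete residue systems\<close>

lemma sum_residues_affine:
  fixes p :: int
  assumes "0 < p" "coprime c p" and periodic: "\<And>x y. [x = y] (mod p) \<Longrightarrow> g x = g y"
  shows "(\<Sum>x\<in>{0..<p}. g (c * x + d)) = (\<Sum>x\<in>{0..<p}. g x)"
proof -
  let ?h = "\<lambda>x. (c * x + d) mod p"
  have inj: "inj_on ?h {0..<p}"
  proof (rule inj_onI)
    fix x y assume xy: "x \<in> {0..<p}" "y \<in> {0..<p}" "?h x = ?h y"
    then have "[x = y] (mod p)"
      using assms(2) by (simp add: cong_def[symmetric] cong_add_rcancel cong_mult_lcancel)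
    then show "x = y"
      using xy by (simp add: cong_def)
  qed
  moreover have "?h ` {0..<p} \<subseteq> {0..<p}"
    using assms(1) by auto
  ultimately have "?h ` {0..<p} = {0..<p}"
    by (simp add: endo_inj_surj)
  then have "(\<Sum>x\<in>{0..<p}. g x) = (\<Sum>x\<in>{0..<p}. g (?h x))"
    using sum.reindex[OF inj, of g] by simp
  also have "\<dots> = (\<Sum>x\<in>{0..<p}. g (c * x + d))"
    by (intro sum.cong refl periodic) (simp add: cong_def)
  finally show ?thesis
    by (rule sym)
qed

context odd_modulus
begin

lemma sum_residues_rotate:
  assumes periodic: "\<And>x x' y y'. [x = x'] (mod p) \<Longrightarrow> [y = y'] (mod p) \<Longrightarrow> g x y = g x' y'"
  shows "(\<Sum>x\<in>{0..<p}. \<Sum>y\<in>{0..<p}. g x y) = (\<Sum>u\<in>{0..<p}. \<Sum>v\<in>{0..<p}. g (v - u) (v + u))"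
proof -
  let ?R = "{0..<p}"
  have stretch: "(\<Sum>u\<in>?R. g x (2 * u + x)) = (\<Sum>y\<in>?R. g x y)" for x
    using modulus_pos
    by (rule sum_residues_affine) (simp_all add: odd_modulus periodic)
  have shift: "(\<Sum>v\<in>?R. g (v - u) (v + u)) = (\<Sum>x\<in>?R. g x (2 * u + x))" for u
  proof -
    have "g x (2 * u + x) = g y (2 * u + y)" if "[x = y] (mod p)" for x y
      using that by (intro periodic cong_add) simp_all
    then have "(\<Sum>v\<in>?R. g (1 * v + - u) (2 * u + (1 * v + - u))) = (\<Sum>x\<in>?R. g x (2 * u + x))"
      using modulus_pos by (intro sum_residues_affine[where g = "\<lambda>x. g x (2 * u + x)"]) simp_all
    then show ?thesis
      by (simp add: algebra_simps)
  qed
  show ?thesis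
    unfolding stretch[symmetric] shift by (rule sum.swap)
qed

lemma sum_residues_even:
  fixes g :: "int \<Rightarrow> 'a :: comm_semiring_1"
  assumes periodic: "\<And>x y. [x = y] (mod p) \<Longrightarrow> g x = g y" and even: "\<And>x. g (- x) = g x"
  shows "(\<Sum>x\<in>{0..<p}. g x) = g 0 + 2 * (\<Sum>x\<in>{1..half}. g x)"
proof -
  have residues: "{0..<p} = insert 0 ({1..half} \<union> {half + 1..2 * half})"
    using modulus_eq half_nonneg by auto
  have "(\<Sum>x\<in>{half + 1..2 * half}. g x) = (\<Sum>x\<in>{1..half}. g (p - x))"
    by (rule sum.reindex_bij_witness[where i = "\<lambda>x. p - x" and j = "\<lambda>x. p - x"])
      (use modulus_eq in auto)
  also have "\<dots> = (\<Sum>x\<in>{1..half}. g (- x))"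
    by (intro sum.cong refl periodic) (simp add: cong_def)
  also have "\<dots> = (\<Sum>x\<in>{1..half}. g x)"
    by (simp only: even)
  finally have upper: "(\<Sum>x\<in>{half + 1..2 * half}. g x) = (\<Sum>x\<in>{1..half}. g x)" .
  have "(\<Sum>x\<in>{0..<p}. g x) = g 0 + (\<Sum>x\<in>{1..half} \<union> {half + 1..2 * half}. g x)"
    unfolding residues by (rule sum.insert) auto
  also have "(\<Sum>x\<in>{1..half} \<union> {half + 1..2 * half}. g x)
      = (\<Sum>x\<in>{1..half}. g x) + (\<Sum>x\<in>{half + 1..2 * half}. g x)"
    by (rule sum.union_disjoint) auto
  finally show ?thesis
    unfolding upper by (simp only: mult_2)
qed

lemma sum_sum_residues_even:
  fixes g :: "int \<Rightarrow> int \<Rightarrow> 'a :: comm_semiring_1"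
  assumes periodic: "\<And>x x' y y'. [x = x'] (mod p) \<Longrightarrow> [y = y'] (mod p) \<Longrightarrow> g x y = g x' y'"
    and even: "\<And>x y. g (- x) y = g x y" "\<And>x y. g x (- y) = g x y"
  shows "(\<Sum>x\<in>{0..<p}. \<Sum>y\<in>{0..<p}. g x y) = g 0 0 + 2 * (\<Sum>x\<in>{1..half}. g x 0)
    + 2 * (\<Sum>y\<in>{1..half}. g 0 y) + 4 * (\<Sum>x\<in>{1..half}. \<Sum>y\<in>{1..half}. g x y)"
proof -
  let ?h = "\<lambda>x. g x 0 + 2 * (\<Sum>y\<in>{1..half}. g x y)"
  have "(\<Sum>y\<in>{0..<p}. g x y) = ?h x" for x
    by (rule sum_residues_even) (auto intro: periodic even)
  then have "(\<Sum>x\<in>{0..<p}. \<Sum>y\<in>{0..<p}. g x y) = (\<Sum>x\<in>{0..<p}. ?h x)"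
    by (simp only:)
  also have "\<dots> = ?h 0 + 2 * (\<Sum>x\<in>{1..half}. ?h x)"
  proof (rule sum_residues_even)
    show "?h x = ?h y" if "[x = y] (mod p)" for x y
      using periodic[OF that cong_refl] by (simp only:)
  qed (simp only: even)
  finally show ?thesis
    by (simp add: sum.distrib sum_distrib_left[symmetric] algebra_simps)
qed

lemma sum_sum_tilde_cmp_mult:
  "(\<Sum>x\<in>{0..<p}. \<Sum>y\<in>{0..<p}. tilde_cmp_mult p c x y)
    = (\<Sum>u\<in>{0..<p}. sgn (u cmod p) * sgn ((c * u) cmod p))\<^sup>2"
proof -
  let ?R = "{0..<p}" and ?s = "\<lambda>u. sgn (u cmod p) * sgn ((c * u) cmod p)"
  have rotated: "tilde_cmp_mult p c (v - u) (v + u) = ?s u * ?s v" for u v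
    unfolding tilde_cmp_mult_def right_diff_distrib distrib_left tilde_cmp_diff_add
    by (simp only: mult_ac)
  have "(\<Sum>x\<in>?R. \<Sum>y\<in>?R. tilde_cmp_mult p c x y)
      = (\<Sum>u\<in>?R. \<Sum>v\<in>?R. tilde_cmp_mult p c (v - u) (v + u))"
    by (rule sum_residues_rotate) (rule tilde_cmp_mult_cong)
  then show ?thesis
    by (simp only: rotated power2_eq_square sum_product)
qed

end

section \<open>The involution induced by a square root of minus one\<close>

locale sqrt_minus_one = odd_modulus +
  fixes t :: int
  assumes square_cong: "[t * t = - 1] (mod p)"
begin

definition bar :: "int \<Rightarrow> int" where
  "bar x = tilde p (t * x)"

lemma mult_mult_cong: "[t * (t * x) = - x] (mod p)"
  using cong_scalar_right[OF square_cong, of x] by (simp add: mult.assoc)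

lemma coprime_modulus: "coprime t p"
proof -
  have "[t * - t = 1] (mod p)"
    using square_cong cong_minus_minus_iff[of "t * t" "- 1" p] by simp
  then show ?thesis
    unfolding coprime_iff_invertible_int by blast
qed

lemma bar_bar: "bar (bar x) = tilde p x"
  using tilde_cong[OF mult_mult_cong] by (simp add: bar_def tilde_mult_tilde)

lemma half_interval_not_dvd: "x \<in> {1..half} \<Longrightarrow> \<not> p dvd x"
  using tilde_eq_0_iff[of x] tilde_eq_self[of x] by auto

lemma bar_in_half_interval:
  assumes "x \<in> {1..half}"
  shows "bar x \<in> {1..half}"
proof -
  have "\<not> p dvd t * x"
    using half_interval_not_dvd[OF assms] coprime_modulus coprime_dvd_mult_right_iff[of p t x]
    by (simp add: coprime_commute)
  then have "bar x \<noteq> 0"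
    by (simp add: bar_def tilde_eq_0_iff)
  then show ?thesis
    using tilde_nonneg[of "t * x"] tilde_le_half[of "t * x"] by (simp add: bar_def)
qed

lemma bar_cong_cases:
  obtains e :: int where "e = 1 \<or> e = - 1"
    "[t * x = e * bar x] (mod p)" "[t * bar x = - (e * x)] (mod p)"
proof -
  obtain e where e: "e = 1 \<or> e = - 1" and tx: "[t * x = e * bar x] (mod p)"
    unfolding bar_def by (rule cong_sign_mult_tilde)
  have "t * bar x = e * t * (e * bar x)"
    using e by auto
  also have "[\<dots> = e * t * (t * x)] (mod p)"
    using tx by (intro cong_scalar_left) (rule cong_sym)
  also have "e * t * (t * x) = e * (t * (t * x))"
    by (rule mult.assoc)
  also have "[\<dots> = e * - x] (mod p)"
    using mult_mult_cong by (rule cong_scalar_left)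
  finally show ?thesis
    using that e tx by simp
qed

lemma bar_neq:
  assumes "x \<in> {1..half}"
  shows "bar x \<noteq> x"
proof
  assume fixed: "bar x = x"
  obtain e where e: "e = 1 \<or> e = - 1" "[t * x = e * bar x] (mod p)"
      "[t * bar x = - (e * x)] (mod p)"
    by (rule bar_cong_cases)
  then have "[e * x = - (e * x)] (mod p)"
    unfolding fixed by (metis cong_sym cong_trans)
  then have "p dvd 2 * (e * x)"
    by (simp add: cong_iff_dvd_diff)
  then have "p dvd e * x"
    using odd_modulus coprime_dvd_mult_right_iff[of p 2 "e * x"] by simp
  then have "p dvd x"
    using e(1) by auto
  then show False
    using half_interval_not_dvd[OF assms] by contradiction
qed

sublocale fixed_point_free_involution "{1..half}" bar
  using bar_in_half_interval bar_neq by unfold_locales (auto simp: bar_bar tilde_eq_self)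

text \<open>
  Multiplication by \<open>t - 1\<close> permutes the orbits of \<open>\<langle>t\<rangle>\<close>; on the openers it is \<open>a \<mapsto> bar a - a\<close>.
\<close>

lemma bar_diff: "bar (bar x - x) = tilde p (bar x + x)"
proof -
  obtain e where e: "e = 1 \<or> e = - 1" "[t * x = e * bar x] (mod p)"
      "[t * bar x = - (e * x)] (mod p)"
    by (rule bar_cong_cases)
  have "[t * bar x - t * x = - (e * x) - e * bar x] (mod p)"
    using e(3,2) by (rule cong_diff)
  then have "[t * (bar x - x) = - (e * (bar x + x))] (mod p)"
    by (simp add: algebra_simps)
  then have "bar (bar x - x) = tilde p (- (e * (bar x + x)))"
    unfolding bar_def[of "bar x - x"] by (rule tilde_cong)
  then show ?thesis
    using e(1) tilde_minus[of "bar x + x"] by auto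
qed

lemma bar_diff_opener:
  assumes "a \<in> openers"
  shows "bar (bar a - a) = min (bar a + a) (p - (bar a + a))"
  using assms bar_in_half_interval[of a] modulus_eq
  by (simp add: bar_diff openers_def tilde_eq_min)

lemma bij_betw_bar_diff: "bij_betw (\<lambda>a. bar a - a) openers openers"
proof -
  have "inj_on (\<lambda>a. bar a - a) openers"
  proof (rule inj_onI)
    fix a b assume openers: "a \<in> openers" "b \<in> openers" and eq: "bar a - a = bar b - b"
    then have "min (bar a + a) (p - (bar a + a)) = min (bar b + b) (p - (bar b + b))"
      by (metis bar_diff_opener)
    then consider (equal) "bar a + a = bar b + b" | (complementary) "bar a + a + (bar b + b) = p"
      by (auto simp: min_def split: if_splits)
    then show "a = b"
    proof cases
      case complementary
      then have "2 * (bar a + b) = p"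
        using eq by simp
      then show ?thesis
        using odd_modulus by presburger
    qed (use eq in simp)
  qed
  moreover have "(\<lambda>a. bar a - a) ` openers \<subseteq> openers"
  proof (rule image_subsetI)
    fix a assume a: "a \<in> openers"
    then have "1 \<le> a" "a < bar a" "bar a \<le> half"
      using bar_in_half_interval[of a] by (auto simp: openers_def)
    then show "bar a - a \<in> openers"
      using modulus_eq bar_diff_opener[OF a] by (auto simp: openers_def)
  qed
  ultimately show ?thesis
    by (simp add: bij_betw_def endo_inj_surj finite_openers)
qed

lemma sum_bar_openers: "(\<Sum>a\<in>openers. bar a) = 2 * \<Sum>openers"
  using sum.reindex_bij_betw[OF bij_betw_bar_diff, of "\<lambda>x. x"] by (simp add: sum_subtractf)

lemma sum_abs_bar_diff: "3 * (\<Sum>x\<in>{1..half}. \<bar>bar x - x\<bar>) = half * (half + 1)"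
proof -
  have "(\<Sum>x\<in>{1..half}. \<bar>bar x - x\<bar>) = (\<Sum>a\<in>openers. 2 * (bar a - a))"
    unfolding sum_eq_sum_openers by (intro sum.cong) (auto simp: openers_def involution)
  also have "\<dots> = 2 * \<Sum>openers"
    by (simp add: sum_distrib_left[symmetric] sum_subtractf sum_bar_openers)
  finally have "3 * (\<Sum>x\<in>{1..half}. \<bar>bar x - x\<bar>) = 2 * \<Sum>{1..half}"
    by (simp add: sum_eq_sum_openers[of "\<lambda>x. x"] sum.distrib sum_bar_openers)
  also have "\<dots> = half * (half + 1)"
  proof (cases "1 \<le> half")
    case True
    then show ?thesis
      by (simp add: Sum_Icc_int)
  next
    case False
    then have "half = 0"
      using half_nonneg by simp
    then show ?thesis
      by simp
  qed
  finally show ?thesis .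
qed

lemma sum_sgn_diff_mult_sgn_diff_bar:
  assumes "x \<in> {1..half}"
  shows "(\<Sum>y\<in>{1..half}. sgn (y - x) * sgn (y - bar x)) = half - 2 * \<bar>bar x - x\<bar>"
proof -
  have between: "(\<Sum>y\<in>{1..half}. sgn (y - a) * sgn (y - b)) = half - 2 * (b - a)"
    if "a \<in> {1..half}" "b \<in> {1..half}" "a < b" for a b
  proof -
    have "{1..half} \<inter> {a<..<b} = {a<..<b}"
      using that by auto
    then show ?thesis
      using that sum_sgn_diff_mult_sgn_diff[of "{1..half}" a b] by simp
  qed
  consider (opener) "x < bar x" | (closer) "bar x < x"
    using bar_neq[OF assms] by linarith
  then show ?thesis
  proof cases
    case opener
    then show ?thesis
      using between[OF assms bar_in_half_interval[OF assms]] by simp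
  next
    case closer
    then show ?thesis
      using between[OF bar_in_half_interval[OF assms] assms] by (simp add: mult.commute)
  qed
qed

lemma card_separated: "24 * int (card separated) = half * (half - 2)"
proof -
  have "8 * int (card separated) = (\<Sum>x\<in>{1..half}. half - 2 * \<bar>bar x - x\<bar>)"
    using sum_sgn_eq_card_separated by (simp add: sum_sgn_diff_mult_sgn_diff_bar)
  also have "\<dots> = half * half - 2 * (\<Sum>x\<in>{1..half}. \<bar>bar x - x\<bar>)"
    using half_nonneg by (simp add: sum_subtractf sum_distrib_left)
  finally show ?thesis
    using sum_abs_bar_diff by (simp add: algebra_simps)
qed

lemma sum_sgn_cmod_mult: "(\<Sum>u\<in>{0..<p}. sgn (u cmod p) * sgn ((t * u) cmod p)) = 0"
proof -
  let ?s = "\<lambda>u. sgn (u cmod p) * sgn ((t * u) cmod p)"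
  have "?s (t * u + 0) = - ?s u" for u
    using cmod_cong[OF mult_mult_cong[of u]] by (simp add: minus_cmod sgn_minus)
  then have "(\<Sum>u\<in>{0..<p}. - ?s u) = (\<Sum>u\<in>{0..<p}. ?s (t * u + 0))"
    by simp
  also have "\<dots> = (\<Sum>u\<in>{0..<p}. ?s u)"
    using modulus_pos coprime_modulus
    by (rule sum_residues_affine) (metis cmod_cong cong_scalar_left)
  finally show ?thesis
    by (simp add: sum_negf)
qed

lemma sum_sgn_bar_diff:
  "(\<Sum>x\<in>{1..half}. \<Sum>y\<in>{1..half}. sgn (y - x) * sgn (bar y - bar x)) = - half"
proof -
  let ?I = "{1..half}" and ?g = "tilde_cmp_mult p t"
  have interior: "?g x y = sgn (y - x) * sgn (bar y - bar x)" if "x \<in> ?I" "y \<in> ?I" for x y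
    using that by (simp add: tilde_cmp_mult_def tilde_cmp_def bar_def tilde_eq_self)
  have axes: "?g x 0 = 1" "?g 0 x = 1" if "x \<in> ?I" for x
    using that bar_in_half_interval[OF that] tilde_eq_0_iff[of 0]
    by (simp_all add: tilde_cmp_mult_def tilde_cmp_def bar_def tilde_eq_self)
  have origin: "?g 0 0 = 0"
    by (simp add: tilde_cmp_mult_def tilde_cmp_def)
  have "0 = (\<Sum>x\<in>{0..<p}. \<Sum>y\<in>{0..<p}. ?g x y)"
    by (simp add: sum_sum_tilde_cmp_mult sum_sgn_cmod_mult)
  also have "\<dots> = ?g 0 0 + 2 * (\<Sum>x\<in>?I. ?g x 0) + 2 * (\<Sum>y\<in>?I. ?g 0 y)
      + 4 * (\<Sum>x\<in>?I. \<Sum>y\<in>?I. ?g x y)"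
    by (rule sum_sum_residues_even) (simp_all add: tilde_cmp_mult_cong)
  also have "\<dots> = 4 * half + 4 * (\<Sum>x\<in>?I. \<Sum>y\<in>?I. ?g x y)"
    using half_nonneg by (simp add: origin axes)
  finally show ?thesis
    by (simp add: interior)
qed

lemma card_separated_eq_card_nested: "card separated = card nested"
  using sum_sgn_eq_card_separated_diff_nested sum_sgn_bar_diff half_nonneg by simp

lemma card_crossing_eq_card_separated: "card crossing = card separated"
proof -
  have "half * half = 2 * half + 8 * (int (card crossing) + 2 * int (card separated))"
    using arg_cong[OF card_chord_pairs, of int] half_nonneg card_separated_eq_card_nested by simp
  then show ?thesis
    using card_separated by (simp add: algebra_simps)
qed

end

section \<open>The half factorial modulo a prime\<close>

lemma fact_half_square_cong:
  fixes n :: nat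
  assumes "prime (2 * n + 1)"
  shows "[fact n * fact n = (- 1) ^ (n + 1)] (mod (2 * int n + 1))"
proof -
  let ?p = "2 * int n + 1"
  have "fact (2 * n) = int (prod Suc {n..<2 * n}) * fact n"
    using fact_split[of n "2 * n", where 'a = int] by simp
  also have "prod Suc {n..<2 * n} = (\<Prod>i\<in>{1..n}. 2 * n + 1 - i)"
    by (rule prod.reindex_bij_witness[where i = "\<lambda>i. 2 * n - i" and j = "\<lambda>i. 2 * n - i"]) auto
  also have "int \<dots> = (\<Prod>i\<in>{1..n}. ?p - int i)"
    by (simp add: of_nat_diff algebra_simps)
  also have "[\<dots> * fact n = (\<Prod>i\<in>{1..n}. - int i) * fact n] (mod ?p)"
    by (intro cong_scalar_right cong_prod) (simp add: cong_iff_dvd_diff)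
  also have "(\<Prod>i\<in>{1..n}. - int i) = (- 1) ^ n * fact n"
    by (simp add: prod_uminus fact_prod)
  finally have "[fact (2 * n) = (- 1) ^ n * (fact n * fact n)] (mod ?p)"
    by (simp only: mult.assoc)
  moreover have "[fact (2 * n) = - 1] (mod ?p)"
    using wilson_theorem[OF assms] by (simp add: add.commute)
  ultimately have "[(- 1) ^ n * (fact n * fact n) = - 1] (mod ?p)"
    using cong_sym cong_trans by blast
  then have "[(- 1) ^ n * ((- 1) ^ n * (fact n * fact n)) = (- 1) ^ n * - 1] (mod ?p)"
    by (rule cong_scalar_left)
  then show ?thesis
    by (simp add: mult.assoc[symmetric] power_add[symmetric])
qed

lemma tval_eq_fact: "0 < p \<Longrightarrow> tval p = fact (nat ((p - 1) div 2))"
  by (simp add: tval_def fact_prod prod_int_eq)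

lemma sqrt_minus_one_tval:
  assumes "prime p" and "[p = 1] (mod 4)"
  shows "sqrt_minus_one p (tval p)"
proof -
  define n where "n = nat ((p - 1) div 2)"
  have "0 < p" "p mod 4 = 1"
    using assms by (simp_all add: prime_gt_0_int cong_def)
  moreover from this have "int n = (p - 1) div 2"
    by (simp add: n_def)
  ultimately have p: "p = 2 * int n + 1" and "odd p" "even n"
    by presburger+
  have "prime (2 * n + 1)"
    using assms(1) p by (metis of_nat_1 of_nat_add of_nat_mult of_nat_numeral prime_int_nat_transfer
        nat_int)
  then have "[fact n * fact n = - 1] (mod p)"
    using fact_half_square_cong[of n] \<open>even n\<close> p by simp
  moreover have "tval p = fact n"
    using \<open>0 < p\<close> unfolding n_def by (rule tval_eq_fact)
  ultimately have "[tval p * tval p = - 1] (mod p)"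
    by simp
  then show ?thesis
    using \<open>0 < p\<close> \<open>odd p\<close> by unfold_locales
qed

theorem theorem3p5:
  fixes p :: int
  assumes "prime p" and "[p = 1] (mod 4)"
  shows "card (X p) = card (Y p) \<and> card (Y p) = card (Z p) \<and>
    real (card (Z p)) = (real_of_int p - 1) * (real_of_int p - 5) / 96"
proof -
  interpret sqrt_minus_one p "tval p"
    using assms by (rule sqrt_minus_one_tval)
  have "V p = openers"
    unfolding V_def openers_def by (auto simp: half_def bar_def)
  then have pairs: "X p = crossing" "Y p = separated" "Z p = nested"
    by (auto simp: X_def Y_def Z_def chord_pair_defs pbar_def bar_def)
  have "24 * real (card separated) = real_of_int half * (real_of_int half - 2)"
    using arg_cong[OF card_separated, of real_of_int] by simp
  moreover have "real_of_int p = 2 * real_of_int half + 1"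
    using arg_cong[OF modulus_eq, of real_of_int] by simp
  ultimately have "real (card separated) = (real_of_int p - 1) * (real_of_int p - 5) / 96"
    by (simp add: field_simps)
  then show ?thesis
    using card_crossing_eq_card_separated card_separated_eq_card_nested by (simp add: pairs)
qed

end
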